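(* Define constants $c_n$ ($n\ge 0$) by the Laurent expansion about $s=1$ $$\mathcal{H}^2(s)=\frac{2}{(s-1)^3}+\frac{2\gamma}{(s-1)^2}+\frac{\gamma^2}{s-1}+\sum_{n=0}^\infty \frac{(-1)^n}{n!}c_n (s-1)^n .$$ Then for every integer $n\ge0$, $$c_n=\lim_{N\to\infty}\left\{\sum_{k=1}^N\frac{H_k^2}{k}\log^n(k)-\frac{\log^{n+3}(N)}{n+3}-2\gamma\frac{\log^{n+2}(N)}{n+2}-\gamma^2\frac{\log^{n+1}(N)}{n+1}\right\}.$$
   Context: $H_k=1+\frac12+\cdots+\frac1k$. $\mathcal{H}^2(s)=\sum_{n\ge1}H_n^2 n^{-s}$ for $\Re(s)>1$, meromorphically continued to $\mathbb{C}$. $\gamma$ is the Euler–Mascheroni constant. *)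

theory Defs
  imports "HOL-Complex_Analysis.Complex_Analysis"
begin

(* Shifted index: the n-th summand is the term for n + 1 of the Dirichlet series. *)
definition harm_sq_dirichlet :: "complex \<Rightarrow> complex" where
  "harm_sq_dirichlet s = (\<Sum>n. (harm (Suc n))\<^sup>2 * of_nat (Suc n) powr (- s))"

(* The library's meromorphic functions carry arbitrary values at a discrete set of points,
   so a continuation is unique only up to its values at isolated points outside Re s > 1.
   The Laurent expansion at 1 below is a condition on a punctured neighbourhood
   and does not see that choice. *)
definition harm_sq_continuation :: "(complex \<Rightarrow> complex) \<Rightarrow> bool" where
  "harm_sq_continuation F \<longleftrightarrow>
     F meromorphic_on UNIV \<and> (\<forall>s. Re s > 1 \<longrightarrow> F s = harm_sq_dirichlet s)"

definition harm_sq_laurent_coeffs :: "(complex \<Rightarrow> complex) \<Rightarrow> (nat \<Rightarrow> complex) \<Rightarrow> bool" where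
  "harm_sq_laurent_coeffs F c \<longleftrightarrow>
     (\<forall>\<^sub>F s in at 1.
        (\<lambda>n. (-1) ^ n / fact n * c n * (s - 1) ^ n) sums
          (F s - (2 / (s - 1) ^ 3 + 2 * euler_mascheroni / (s - 1) ^ 2
                  + euler_mascheroni ^ 2 / (s - 1))))"

end

theory Submission
  imports Defs "HOL-Real_Asymp.Real_Asymp"
begin

text \<open>Put $t = s - 1$ and let $A(t, L) = \int_0^L (u + \gamma)^2 e^{-tu}\,du$, an entire function
of $t$. The functions $G_N(t) = \sum_{k \le N} H_k^2 k^{-1-t} - A(t, \log N)$ have Taylor
coefficients $(-1)^n/n!$ times the bracket of the theorem. Since
$H_k = \log k + \gamma + O(1/k)$, the increments $G_{N+1} - G_N$ are $O(N^{-3/2})$ uniformly for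
$|t| < 1/4$, so $G_N$ converges uniformly and the Taylor coefficients converge as well.
For real $t > 0$, $A(t, \log N)$ tends to the principal part of the Laurent expansion, so there
the limit is the Dirichlet series minus the principal part; as these points accumulate at $t = 0$,
the same holds for the continuation near $s = 1$.\<close>

section \<open>Taylor expansions of the integral and of the regularized partial sums\<close>

text \<open>The integral of \<open>u ^ n * (u + \<gamma>) ^ 2\<close> over
  \<open>[0, L]\<close>.\<close>

definition log_antideriv :: "nat \<Rightarrow> real \<Rightarrow> real" where
  "log_antideriv n L = L ^ (n + 3) / real (n + 3) + 2 * euler_mascheroni * (L ^ (n + 2) / real (n + 2))
     + euler_mascheroni ^ 2 * (L ^ (n + 1) / real (n + 1))"

text \<open>For Re t > 0 this is the integral of \<open>(u + \<gamma>) ^ 2 * exp (- t * u)\<close>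
  over the whole half-line from 0.\<close>

definition principal_part :: "complex \<Rightarrow> complex" where
  "principal_part t = 2 / t ^ 3 + 2 * euler_mascheroni / t ^ 2 + euler_mascheroni ^ 2 / t"

text \<open>The integral of $(u + \gamma)^2 e^{-tu}$ over $[0, L]$ in closed form.\<close>

definition exp_antideriv :: "complex \<Rightarrow> real \<Rightarrow> complex" where
  "exp_antideriv t L =
     (if t = 0 then of_real L ^ 3 / 3 + euler_mascheroni * of_real L ^ 2 + euler_mascheroni ^ 2 * of_real L
      else principal_part t - exp (- t * of_real L) *
        ((of_real L + euler_mascheroni) ^ 2 / t + 2 * (of_real L + euler_mascheroni) / t ^ 2 + 2 / t ^ 3))"

lemma exp_antideriv_0 [simp]: "exp_antideriv t 0 = 0"
  by (simp add: exp_antideriv_def principal_part_def)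

lemma exp_antideriv_has_vector_derivative:
  "(exp_antideriv t has_vector_derivative
     exp (- t * of_real L) * (of_real L + euler_mascheroni) ^ 2) (at L within S)"
proof -
  \<comment> \<open>The real variable \<open>L\<close> is replaced by a complex \<open>z\<close>, so
    that complex differentiation rules apply; composing with the embedding of the reals gives the
    claim.\<close>
  have "((\<lambda>z. if t = 0 then z ^ 3 / 3 + euler_mascheroni * z ^ 2 + euler_mascheroni ^ 2 * z
      else principal_part t - exp (- t * z) *
        ((z + euler_mascheroni) ^ 2 / t + 2 * (z + euler_mascheroni) / t ^ 2 + 2 / t ^ 3))
      has_field_derivative exp (- t * of_real L) * (of_real L + euler_mascheroni) ^ 2)
      (at (of_real L) within of_real ` S)"
  proof (cases "t = 0")
    case True
    thus ?thesis
      by (auto intro!: derivative_eq_intros simp: power2_eq_square field_simps)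
  next
    case False
    thus ?thesis
      by (auto intro!: derivative_eq_intros simp: field_simps power2_eq_square power3_eq_cube)
  qed
  from field_vector_diff_chain_within[OF has_vector_derivative_of_real [OF DERIV_ident] this]
  show ?thesis
    by (simp add: exp_antideriv_def [abs_def] o_def)
qed

text \<open>Building blocks for the series of \<open>exp_antideriv\<close>: its coefficients involve
  \<open>1 / (n! * (n + j))\<close> with j = 1, 2, 3, which are combinations of reciprocals of
  \<open>(n + 1)!\<close>, \<open>(n + 2)!\<close>, \<open>(n + 3)!\<close>.\<close>

lemma exp_series_tails:
  fixes z :: complex
  assumes "z \<noteq> 0"
  shows "(\<lambda>n. z ^ n / fact (n + 1)) sums ((exp z - 1) / z)"
    and "(\<lambda>n. z ^ n / fact (n + 2)) sums ((exp z - 1 - z) / z ^ 2)"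
    and "(\<lambda>n. z ^ n / fact (n + 3)) sums ((exp z - 1 - z - z ^ 2 / 2) / z ^ 3)"
proof -
  have *: "(\<lambda>n. z ^ n / fact (n + k)) sums ((exp z - (\<Sum>i<k. z ^ i / fact i)) / z ^ k)" for k
  proof -
    have "(\<lambda>n. z ^ n / fact n) sums exp z"
      using exp_converges[of z] by (simp add: scaleR_conv_of_real field_simps)
    hence "(\<lambda>n. z ^ (n + k) / fact (n + k)) sums (exp z - (\<Sum>i<k. z ^ i / fact i))"
      by (subst sums_iff_shift) simp
    from sums_divide[OF this, of "z ^ k"] show ?thesis
      using assms by (simp add: power_add)
  qed
  show "(\<lambda>n. z ^ n / fact (n + 1)) sums ((exp z - 1) / z)"
    "(\<lambda>n. z ^ n / fact (n + 2)) sums ((exp z - 1 - z) / z ^ 2)"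
    "(\<lambda>n. z ^ n / fact (n + 3)) sums ((exp z - 1 - z - z ^ 2 / 2) / z ^ 3)"
    using *[of 1] *[of 2] *[of 3] by (simp_all add: eval_nat_numeral algebra_simps)
qed

text \<open>Termwise integration of the series of \<open>exp (- t * u)\<close> against
  \<open>(u + \<gamma>) ^ 2\<close> suggests these coefficients. The proof compares closed forms
  instead; \<open>t = 0\<close> and \<open>L = 0\<close> are split off because the tails are divided
  by powers of \<open>- t * L\<close>.\<close>

lemma exp_antideriv_sums:
  "(\<lambda>n. (-1) ^ n / fact n * of_real (log_antideriv n L) * t ^ n) sums exp_antideriv t L"
proof (cases "t = 0 \<or> L = 0")
  case True
  thus ?thesis
  proof
    assume "t = 0"
    thus ?thesis
      using sums_single[of 0 "\<lambda>n. (-1) ^ n / fact n * of_real (log_antideriv n L) * t ^ n"]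
      by (simp add: exp_antideriv_def log_antideriv_def power_0_left power2_eq_square if_distrib mult_ac cong: if_cong)
  next
    assume "L = 0"
    thus ?thesis by (simp add: log_antideriv_def power_add)
  qed
next
  case False
  define l where "l = complex_of_real L"
  define z where "z = - t * l"
  have nz: "t \<noteq> 0" "l \<noteq> 0" "z \<noteq> 0" using False by (auto simp: l_def z_def)
  let ?g = "euler_mascheroni :: complex"
  define S1 S2 S3 where "S1 = (exp z - 1) / z" and "S2 = (exp z - 1 - z) / z ^ 2"
    and "S3 = (exp z - 1 - z - z ^ 2 / 2) / z ^ 3"
  \<comment> \<open>The combinations come from \<open>1 / (n! * (n + 3)) = 1 / (n + 1)! - 2 / (n +
    2)! + 2 / (n + 3)!\<close> and \<open>1 / (n! * (n + 2)) = 1 / (n + 1)! - 1 / (n + 2)!\<close>,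
    with one line for each power of \<gamma>.\<close>
  have "(\<lambda>n. l ^ 3 * (z ^ n / fact (n + 1) - 2 * (z ^ n / fact (n + 2)) + 2 * (z ^ n / fact (n + 3)))
       + 2 * ?g * l ^ 2 * (z ^ n / fact (n + 1) - z ^ n / fact (n + 2))
       + ?g ^ 2 * l * (z ^ n / fact (n + 1))) sums
       (l ^ 3 * (S1 - 2 * S2 + 2 * S3) + 2 * ?g * l ^ 2 * (S1 - S2) + ?g ^ 2 * l * S1)"
    unfolding S1_def S2_def S3_def
    by (intro sums_add sums_mult sums_diff exp_series_tails nz)
  also have "(\<lambda>n. l ^ 3 * (z ^ n / fact (n + 1) - 2 * (z ^ n / fact (n + 2)) + 2 * (z ^ n / fact (n + 3)))
       + 2 * ?g * l ^ 2 * (z ^ n / fact (n + 1) - z ^ n / fact (n + 2))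
       + ?g ^ 2 * l * (z ^ n / fact (n + 1))) =
      (\<lambda>n. (-1) ^ n / fact n * of_real (log_antideriv n L) * t ^ n)"
  proof
    fix n
    have nz': "of_nat n + 1 \<noteq> (0 :: complex)" "of_nat n + 2 \<noteq> (0 :: complex)" "of_nat n + 3 \<noteq> (0 :: complex)"
      using of_nat_neq_0[of n, where ?'a = complex] of_nat_neq_0[of "n + 1", where ?'a = complex]
        of_nat_neq_0[of "n + 2", where ?'a = complex] by (simp_all add: add_ac)
    define w where "w = z ^ n / fact n"
    define x where "x = (of_nat n :: complex)"
    have x: "x + 1 \<noteq> 0" "x + 2 \<noteq> 0" "x + 3 \<noteq> 0" using nz' by (simp_all add: x_def)
    have f: "z ^ n / fact (n + 1) = w / (x + 1)" "z ^ n / fact (n + 2) = w / ((x + 1) * (x + 2))"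
      "z ^ n / fact (n + 3) = w / ((x + 1) * (x + 2) * (x + 3))"
      by (simp_all add: w_def x_def eval_nat_numeral algebra_simps)
    have "(-1) ^ n / fact n * of_real (log_antideriv n L) * t ^ n =
      w * (l ^ 3 / (x + 3) + 2 * ?g * (l ^ 2 / (x + 2)) + ?g ^ 2 * (l / (x + 1)))"
      by (simp add: log_antideriv_def w_def z_def l_def x_def power_add power_mult_distrib power_minus[of "t * _"]
          power2_eq_square algebra_simps add_divide_distrib)
    moreover have e: "w / (x + 1) - 2 * (w / ((x + 1) * (x + 2))) + 2 * (w / ((x + 1) * (x + 2) * (x + 3))) = w / (x + 3)"
      "w / (x + 1) - w / ((x + 1) * (x + 2)) = w / (x + 2)"
      using x by (auto simp: divide_simps) (auto simp: algebra_simps)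
    ultimately show "l ^ 3 * (z ^ n / fact (n + 1) - 2 * (z ^ n / fact (n + 2)) + 2 * (z ^ n / fact (n + 3)))
       + 2 * ?g * l ^ 2 * (z ^ n / fact (n + 1) - z ^ n / fact (n + 2))
       + ?g ^ 2 * l * (z ^ n / fact (n + 1)) = (-1) ^ n / fact n * of_real (log_antideriv n L) * t ^ n"
      unfolding f e by (simp add: algebra_simps)
  qed
  also have "l ^ 3 * (S1 - 2 * S2 + 2 * S3) + 2 * ?g * l ^ 2 * (S1 - S2) + ?g ^ 2 * l * S1 = exp_antideriv t L"
  proof -
    \<comment> \<open>With \<open>exp z\<close> made opaque, the claim becomes an identity of
      rational functions.\<close>
    define E where "E = exp z"
    have eq: "exp_antideriv t L = principal_part t - E * ((l + ?g) ^ 2 / t + 2 * (l + ?g) / t ^ 2 + 2 / t ^ 3)"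
      using nz by (simp add: exp_antideriv_def E_def z_def l_def)
    have A: "l * S1 = (1 - E) / t" "l ^ 2 * S2 = (E - 1 + t * l) / t ^ 2"
      "l ^ 3 * S3 = (1 - E - t * l + t ^ 2 * l ^ 2 / 2) / t ^ 3"
      unfolding S1_def S2_def S3_def E_def [symmetric] unfolding z_def using nz
      by (simp_all add: field_simps power2_eq_square power3_eq_cube)
    have "l ^ 3 * (S1 - 2 * S2 + 2 * S3) + 2 * ?g * l ^ 2 * (S1 - S2) + ?g ^ 2 * l * S1 =
      l ^ 2 * (l * S1) - 2 * l * (l ^ 2 * S2) + 2 * (l ^ 3 * S3)
      + 2 * ?g * (l * (l * S1) - l ^ 2 * S2) + ?g ^ 2 * (l * S1)"
      by (simp add: algebra_simps power2_eq_square power3_eq_cube)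
    also have "\<dots> = principal_part t - E * ((l + ?g) ^ 2 / t + 2 * (l + ?g) / t ^ 2 + 2 / t ^ 3)"
      unfolding A principal_part_def using nz(1)
      by (simp add: field_simps power2_eq_square power3_eq_cube)
    finally show ?thesis by (simp only: eq)
  qed
  finally show ?thesis .
qed

text \<open>At \<open>N = 0\<close> the bracket vanishes because \<open>ln 0 = 0\<close>.\<close>

definition laurent_bracket :: "nat \<Rightarrow> nat \<Rightarrow> real" where
  "laurent_bracket n N = (\<Sum>k=1..N. (harm k)\<^sup>2 / real k * ln (real k) ^ n) - log_antideriv n (ln (real N))"

text \<open>The function G_N of the outline. The power of k is split into \<open>1 / k\<close> and
  an exponential, so that each summand expands directly in powers of \<open>t\<close>.\<close>

definition regular_part :: "nat \<Rightarrow> complex \<Rightarrow> complex" where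
  "regular_part N t = (\<Sum>k=1..N. of_real ((harm k)\<^sup>2 / real k) * exp (- t * of_real (ln (real k))))
     - exp_antideriv t (ln (real N))"

lemma regular_part_sums:
  "(\<lambda>n. (-1) ^ n / fact n * of_real (laurent_bracket n N) * t ^ n) sums regular_part N t"
proof -
  have "(\<lambda>n. of_real ((harm k)\<^sup>2 / real k) * ((- t * of_real (ln (real k))) ^ n / fact n)) sums
     (of_real ((harm k)\<^sup>2 / real k) * exp (- t * of_real (ln (real k))))" for k
    using exp_converges[of "- t * of_real (ln (real k))"]
    by (intro sums_mult) (simp add: scaleR_conv_of_real field_simps)
  hence "(\<lambda>n. (\<Sum>k=1..N. of_real ((harm k)\<^sup>2 / real k) * ((- t * of_real (ln (real k))) ^ n / fact n))
       - (-1) ^ n / fact n * of_real (log_antideriv n (ln (real N))) * t ^ n) sums regular_part N t"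
    unfolding regular_part_def by (intro sums_diff sums_sum exp_antideriv_sums)
  also have "(\<lambda>n. (\<Sum>k=1..N. of_real ((harm k)\<^sup>2 / real k) * ((- t * of_real (ln (real k))) ^ n / fact n))
       - (-1) ^ n / fact n * of_real (log_antideriv n (ln (real N))) * t ^ n) =
      (\<lambda>n. (-1) ^ n / fact n * of_real (laurent_bracket n N) * t ^ n)"
    by (intro ext) (simp add: laurent_bracket_def algebra_simps sum_distrib_left sum_distrib_right
        power_mult_distrib power_minus[of "t * _"] sum_divide_distrib diff_divide_distrib)
  finally show ?thesis .
qed

section \<open>Bounds for the increments of the regularized partial sums\<close>

text \<open>The sequence \<open>harm m - ln m\<close> decreases to \<gamma>, which gives the lower
  bound. The upper bound follows from the known estimate of \<gamma> from below by
  \<open>harm m - ln (m + 1)\<close>, since \<open>ln (m + 1) - ln m\<close> is at most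
  \<open>1 / m\<close>.\<close>

lemma harm_minus_ln_bounds:
  assumes "m \<ge> 1"
  shows "0 \<le> harm m - ln (real m) - euler_mascheroni"
    and "harm m - ln (real m) - euler_mascheroni \<le> 1 / real m"
proof -
  have ln: "ln (real (Suc m)) - ln (real m) \<le> 1 / real m"
    using ln_diff_le[of "real (Suc m)" "real m"] assms by simp
  have "harm m - ln (real (Suc m)) + inverse (real (2 * (m + 1))) \<le> euler_mascheroni"
    using euler_mascheroni_bounds[OF assms] by simp
  moreover have "0 < inverse (real (2 * (m + 1)))" by simp
  ultimately show "harm m - ln (real m) - euler_mascheroni \<le> 1 / real m"
    using ln by linarith
  have "euler_mascheroni \<le> harm m - ln (real m)"
  proof (rule tendsto_upperbound [OF euler_mascheroni_LIMSEQ])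
    show "eventually (\<lambda>n. harm n - ln (real n) \<le> harm m - ln (real m)) sequentially"
      using eventually_ge_at_top[of m]
      by eventually_elim (use assms euler_mascheroni_sequence_decreasing in simp)
  qed simp
  thus "0 \<le> harm m - ln (real m) - euler_mascheroni" by simp
qed


lemma euler_mascheroni_le_1: "euler_mascheroni \<le> (1 :: real)"
  using harm_minus_ln_bounds(1)[of 1] by (simp add: harm_def)

text \<open>At \<open>z = ln x\<close> this is
  \<open>x powr (-1 - t) * (ln x + \<gamma>) ^ 2\<close>: both the derivative of
  \<open>exp_antideriv t (ln x)\<close> in x and the approximation to the summand of
  \<open>regular_part\<close> at x.\<close>

definition log_sq_kernel :: "complex \<Rightarrow> complex \<Rightarrow> complex" where
  "log_sq_kernel t z = exp (- (1 + t) * z) * (z + euler_mascheroni) ^ 2"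

text \<open>Since Re t \<ge> -1/4, the exponential is at most \<open>x powr (-3/4)\<close>. The
  extra division by x matches the chain rule for \<open>ln\<close> in one use and the error
  \<open>1 / m\<close> of the harmonic numbers in the other.\<close>

lemma norm_exp_neg_ln_le:
  fixes t :: complex
  assumes "norm t \<le> 1 / 4" "1 \<le> a" "a \<le> x"
  shows "norm (exp (- (1 + t) * of_real (ln x))) / x \<le> a powr (- 7 / 4)"
proof -
  have "Re t \<ge> - (1 / 4)"
    using assms(1) abs_Re_le_cmod[of t] by linarith
  hence "(3 / 4) * ln x \<le> (1 + Re t) * ln x"
    using assms by (intro mult_right_mono) auto
  hence "norm (exp (- (1 + t) * of_real (ln x))) \<le> x powr (- 3 / 4)"
    using assms by (simp add: powr_def algebra_simps)
  hence "norm (exp (- (1 + t) * of_real (ln x))) / x \<le> x powr (- 3 / 4) / x"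
    using assms by (intro divide_right_mono) auto
  also have "\<dots> = x powr (- 7 / 4)"
    using assms powr_diff[of x "- 3 / 4" 1] by simp
  also have "\<dots> \<le> a powr (- 7 / 4)"
    using assms by (intro powr_mono2') auto
  finally show ?thesis .
qed

text \<open>Mean value inequality: the derivative of the kernel along \<open>ln\<close> gains a
  factor \<open>1 / u\<close>, and its polynomial factor is at most
  \<open>2 * L + 2 * L ^ 2\<close>, hence \<open>4 * L ^ 2\<close>, with
  \<open>L = ln b + 1\<close>.\<close>

lemma log_sq_kernel_dist_le:
  assumes t: "norm t \<le> 1 / 4" and a: "1 \<le> a" and x: "x \<in> {a..b}" and y: "y \<in> {a..b}"
  shows "norm (log_sq_kernel t (of_real (ln x)) - log_sq_kernel t (of_real (ln y))) \<le>
    4 * (ln b + 1)\<^sup>2 * a powr (- 7 / 4) * \<bar>x - y\<bar>"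
proof -
  define D where "D = (\<lambda>x. of_real (1 / x) * (exp (- (1 + t) * of_real (ln x)) *
    (2 * (of_real (ln x) + euler_mascheroni) - (1 + t) * (of_real (ln x) + euler_mascheroni) ^ 2)))"
  have deriv: "((\<lambda>x. log_sq_kernel t (of_real (ln x))) has_vector_derivative D u) (at u within {a..b})"
    if "u \<in> {a..b}" for u
  proof -
    have "(log_sq_kernel t has_field_derivative exp (- (1 + t) * z) *
      (2 * (z + euler_mascheroni) - (1 + t) * (z + euler_mascheroni) ^ 2)) (at z within A)" for z A
      unfolding log_sq_kernel_def
      by (rule derivative_eq_intros refl | simp)+ (simp add: algebra_simps power2_eq_square)
    moreover have "((\<lambda>x. of_real (ln x)) has_vector_derivative of_real (1 / u)) (at u within {a..b})"
      using that a by (intro has_vector_derivative_of_real derivative_eq_intros) auto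
    ultimately show ?thesis
      unfolding D_def using field_vector_diff_chain_within by (fastforce simp: o_def)
  qed
  have bound: "norm (D u) \<le> 4 * (ln b + 1)\<^sup>2 * a powr (- 7 / 4)" if "u \<in> {a..b}" for u
  proof -
    define L where "L = ln b + 1"
    have "ln u \<le> ln b" "0 \<le> ln u" using that a by auto
    hence L: "L \<ge> 1" "norm (complex_of_real (ln u) + euler_mascheroni) \<le> L"
    proof -
      have "norm (complex_of_real (ln u + euler_mascheroni)) = ln u + euler_mascheroni"
        unfolding norm_of_real using \<open>0 \<le> ln u\<close> euler_mascheroni_pos by linarith
      with \<open>ln u \<le> ln b\<close> \<open>0 \<le> ln u\<close> show "L \<ge> 1" "norm (complex_of_real (ln u) + euler_mascheroni) \<le> L"
        using euler_mascheroni_le_1 by (simp_all add: L_def)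
    qed
    have "norm (1 + t) \<le> 2"
      using t norm_triangle_ineq[of 1 t] by simp
    hence "norm ((1 + t) * (of_real (ln u) + euler_mascheroni) ^ 2) \<le> 2 * L ^ 2"
      unfolding norm_mult norm_power using L by (intro mult_mono power_mono) auto
    moreover have "norm (2 * (complex_of_real (ln u) + euler_mascheroni)) \<le> 2 * L"
      unfolding norm_mult using L by simp
    ultimately have "norm (2 * (complex_of_real (ln u) + euler_mascheroni) - (1 + t) * (of_real (ln u) + euler_mascheroni) ^ 2)
       \<le> 2 * L + 2 * L ^ 2"
      by (intro order_trans [OF norm_triangle_ineq4] add_mono)
    also have "\<dots> \<le> 4 * L ^ 2"
      using L by (simp add: power2_eq_square)
    finally have "norm (exp (- (1 + t) * of_real (ln u))) / u *
        norm (2 * (complex_of_real (ln u) + euler_mascheroni) - (1 + t) * (of_real (ln u) + euler_mascheroni) ^ 2)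
      \<le> a powr (- 7 / 4) * (4 * L ^ 2)"
      using that a t by (intro mult_mono norm_exp_neg_ln_le) auto
    thus ?thesis
      using that a unfolding D_def L_def by (simp add: norm_mult norm_divide mult_ac)
  qed
  show ?thesis
    unfolding real_norm_def [symmetric]
  proof (rule differentiable_bound [where S = "{a..b}" and f' = "\<lambda>u h. h *\<^sub>R D u"])
    fix u assume u: "u \<in> {a..b}"
    show "((\<lambda>x. log_sq_kernel t (of_real (ln x))) has_derivative (\<lambda>h. h *\<^sub>R D u)) (at u within {a..b})"
      using deriv[OF u] by (simp add: has_vector_derivative_def)
    show "onorm (\<lambda>h. h *\<^sub>R D u) \<le> 4 * (ln b + 1)\<^sup>2 * a powr (- 7 / 4)"
    proof (rule onorm_le)
      fix h :: real
      have "norm (h *\<^sub>R D u) = norm (D u) * norm h" by simp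
      also have "\<dots> \<le> 4 * (ln b + 1)\<^sup>2 * a powr (- 7 / 4) * norm h"
        by (intro mult_right_mono bound u) simp
      finally show "norm (h *\<^sub>R D u) \<le> 4 * (ln b + 1)\<^sup>2 * a powr (- 7 / 4) * norm h" .
    qed
  qed (use x y in auto)
qed

lemma regular_part_0 [simp]: "regular_part 0 t = 0"
  by (simp add: regular_part_def)

text \<open>Two errors add up, with m = N + 1: replacing \<open>harm m\<close> by
  \<open>ln m + \<gamma>\<close> in the new summand costs the 3 in 7 = 3 + 4, and replacing the
  integral over \<open>[N, m]\<close> by the value at its right endpoint costs the 4.\<close>

lemma norm_regular_part_Suc_diff_le:
  assumes N: "N \<ge> 1" and t: "norm t \<le> 1 / 4"
  shows "norm (regular_part (Suc N) t - regular_part N t) \<le>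
     7 * (ln (real (Suc N)) + 1)\<^sup>2 * real N powr (- 7 / 4)"
proof -
  define m where "m = real (Suc N)"
  define L where "L = ln m + 1"
  define H where "H = (harm (Suc N) :: real)"
  define E where "E = exp (- (1 + t) * of_real (ln m))"
  define p where "p = real N powr (- 7 / 4)"
  have m: "m \<ge> 1" "m > 0" "m = real N + 1" by (auto simp: m_def)
  have L: "L \<ge> 1" using m by (simp add: L_def)
  have deriv: "((\<lambda>x. exp_antideriv t (ln x)) has_vector_derivative log_sq_kernel t (of_real (ln x)))
    (at x within {real N..m})" if "x \<in> {real N..m}" for x
  proof -
    have "x > 0" using that N by auto
    hence "(ln has_vector_derivative 1 / x) (at x within {real N..m})"
      unfolding has_real_derivative_iff_has_vector_derivative [symmetric]
      by (intro derivative_eq_intros) auto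
    from vector_diff_chain_within[OF this exp_antideriv_has_vector_derivative]
    have "((\<lambda>x. exp_antideriv t (ln x)) has_vector_derivative
      (1 / x) *\<^sub>R (exp (- t * of_real (ln x)) * (of_real (ln x) + euler_mascheroni) ^ 2)) (at x within {real N..m})"
      by (simp add: o_def)
    also have "exp (- (1 + t) * complex_of_real (ln x)) = exp (- t * of_real (ln x)) / of_real x"
      using \<open>x > 0\<close> by (simp add: algebra_simps exp_diff exp_minus exp_of_real field_simps)
    hence "(1 / x) *\<^sub>R (exp (- t * of_real (ln x)) * (of_real (ln x) + euler_mascheroni) ^ 2) =
      log_sq_kernel t (of_real (ln x))"
      by (simp add: log_sq_kernel_def scaleR_conv_of_real)
    finally show ?thesis .
  qed
  \<comment> \<open>Right endpoint rule on an interval of length 1: its error is bounded by the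
    oscillation of the kernel there.\<close>
  have "norm (exp_antideriv t (ln m) - exp_antideriv t (ln (real N))
      - (m - real N) *\<^sub>R log_sq_kernel t (of_real (ln m))) \<le> norm (m - real N) * (4 * L\<^sup>2 * p)"
  proof (rule vector_differentiable_bound_linearization [OF deriv])
    fix x assume x: "x \<in> {real N..m}"
    have "norm (log_sq_kernel t (of_real (ln x)) - log_sq_kernel t (of_real (ln m))) \<le>
      4 * L\<^sup>2 * p * \<bar>x - m\<bar>"
      unfolding L_def p_def using N x m by (intro log_sq_kernel_dist_le t) auto
    also have "\<dots> \<le> 4 * L\<^sup>2 * p * 1"
      using x m by (intro mult_left_mono) (auto simp: p_def)
    finally show "norm (log_sq_kernel t (of_real (ln x)) - log_sq_kernel t (of_real (ln m))) \<le> 4 * L\<^sup>2 * p"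
      by simp
  qed (use m in \<open>auto simp: closed_segment_eq_real_ivl\<close>)
  hence 1: "norm (exp_antideriv t (ln m) - exp_antideriv t (ln (real N)) - log_sq_kernel t (of_real (ln m)))
      \<le> 4 * L\<^sup>2 * p"
    using m by simp
  have 2: "norm (of_real (H\<^sup>2 - (ln m + euler_mascheroni)\<^sup>2) * E) \<le> 3 * L\<^sup>2 * p"
  proof -
    have H: "0 \<le> H - ln m - euler_mascheroni" "H - ln m - euler_mascheroni \<le> 1 / m"
      unfolding H_def m_def by (intro harm_minus_ln_bounds; simp)+
    have "0 \<le> ln m" using m by auto
    moreover have "H - ln m - euler_mascheroni \<le> 1"
      by (rule order_trans [OF H(2)]) (use m in auto)
    ultimately have H': "H + ln m + euler_mascheroni \<le> 3 * L"
      using euler_mascheroni_le_1 unfolding L_def distrib_left by linarith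
    have H'': "0 \<le> H + ln m + euler_mascheroni"
      using H(1) \<open>0 \<le> ln m\<close> euler_mascheroni_pos by linarith
    \<comment> \<open>The first factor is at most \<open>1 / m\<close> and supplies the missing
      power of m; the second grows only like a logarithm.\<close>
    have "H\<^sup>2 - (ln m + euler_mascheroni)\<^sup>2 = (H - ln m - euler_mascheroni) * (H + ln m + euler_mascheroni)"
      by (simp add: algebra_simps power2_eq_square)
    also have "\<bar>\<dots>\<bar> \<le> 1 / m * (3 * L)"
      unfolding abs_mult using H H' H'' m by (intro mult_mono) auto
    finally have "norm (of_real (H\<^sup>2 - (ln m + euler_mascheroni)\<^sup>2) * E) \<le> 1 / m * (3 * L) * norm E"
      unfolding norm_mult norm_of_real by (rule mult_right_mono) simp
    also have "\<dots> = 3 * L * (norm E / m)" by simp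
    also have "\<dots> \<le> 3 * L\<^sup>2 * p"
      unfolding E_def p_def using L N t m
      by (intro mult_mono norm_exp_neg_ln_le) (auto simp: power2_eq_square)
    finally show ?thesis .
  qed
  have "exp (- (1 + t) * complex_of_real (ln m)) = exp (- t * of_real (ln m)) / of_real m"
    using m(2) by (simp add: algebra_simps exp_diff exp_minus exp_of_real field_simps)
  moreover have "of_nat (Suc N) = complex_of_real m" by (simp add: m_def)
  ultimately have "regular_part (Suc N) t - regular_part N t =
      of_real (H\<^sup>2 - (ln m + euler_mascheroni)\<^sup>2) * E
      - (exp_antideriv t (ln m) - exp_antideriv t (ln (real N)) - log_sq_kernel t (of_real (ln m)))"
    unfolding regular_part_def log_sq_kernel_def E_def m_def [symmetric] H_def
    by (simp add: algebra_simps m_def [symmetric] del: of_nat_Suc)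
  also have "norm \<dots> \<le> 3 * L\<^sup>2 * p + 4 * L\<^sup>2 * p"
    by (intro order_trans [OF norm_triangle_ineq4] add_mono 1 2)
  finally show ?thesis by (simp add: L_def m_def p_def)
qed

section \<open>Uniform limit near 0 and Taylor coefficients\<close>

text \<open>Weierstrass M-test for the telescoping series of increments, which starts from
  \<open>regular_part 0 t = 0\<close>.\<close>

lemma regular_part_uniform_limit:
  obtains G where "uniform_limit (ball 0 (1 / 4)) regular_part G sequentially"
proof -
  have "summable (\<lambda>N. 7 * (ln (real (Suc N)) + 1)\<^sup>2 * real N powr (- 7 / 4))"
  proof (rule summable_comparison_test_bigo)
    show "summable (\<lambda>N. norm (real N powr (- 3 / 2)))"
      by (simp add: summable_real_powr_iff)
    \<comment> \<open>The exponent -3/2 lies between -7/4 and -1, which leaves room to absorb the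
      squared logarithm.\<close>
    show "(\<lambda>N. 7 * (ln (real (Suc N)) + 1)\<^sup>2 * real N powr (- 7 / 4)) \<in> O(\<lambda>N. real N powr (- 3 / 2))"
      by real_asymp
  qed
  \<comment> \<open>The bound fails at \<open>N = 0\<close>, where \<open>0 powr (-7/4)\<close> is 0
    but the increment is 1; hence the eventual form.\<close>
  moreover have "\<forall>\<^sub>F N in sequentially. \<forall>t\<in>ball 0 (1 / 4).
      norm (regular_part (Suc N) t - regular_part N t) \<le>
        7 * (ln (real (Suc N)) + 1)\<^sup>2 * real N powr (- 7 / 4)"
    using eventually_ge_at_top[of 1]
  proof eventually_elim
    case (elim N)
    thus ?case using norm_regular_part_Suc_diff_le[OF elim] by auto
  qed
  ultimately have "uniform_limit (ball 0 (1 / 4)) (\<lambda>N t. \<Sum>i<N. regular_part (Suc i) t - regular_part i t)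
      (\<lambda>t. \<Sum>i. regular_part (Suc i) t - regular_part i t) sequentially"
    by (intro Weierstrass_m_test_ev)
  also have "(\<lambda>N t. \<Sum>i<N. regular_part (Suc i) t - regular_part i t) = regular_part"
    by (simp add: fun_eq_iff sum_lessThan_telescope [where f = "\<lambda>i. regular_part i _"])
  finally show ?thesis using that by blast
qed

lemma regular_part_has_fps_expansion:
  "regular_part N has_fps_expansion Abs_fps (\<lambda>n. (-1) ^ n / fact n * of_real (laurent_bracket n N))"
  by (intro has_fps_expansionI always_eventually allI) (simp only: fps_nth_Abs_fps regular_part_sums)

lemma regular_part_higher_deriv:
  "(deriv ^^ n) (regular_part N) 0 = (-1) ^ n * of_real (laurent_bracket n N)"
  using fps_nth_fps_expansion[OF regular_part_has_fps_expansion, of N n] by simp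

lemma regular_part_holomorphic: "regular_part N holomorphic_on ball 0 r"
  by (rule power_series_holomorphic [where a = "\<lambda>n. (-1) ^ n / fact n * of_real (laurent_bracket n N)"])
     (use regular_part_sums in simp)

section \<open>Comparison with the Dirichlet series on the real axis\<close>

lemma exp_antideriv_tendsto_principal_part:
  assumes "x > 0"
  shows "(\<lambda>N. exp_antideriv (of_real x) (ln (real N))) \<longlonglongrightarrow> principal_part (of_real x)"
proof -
  define w where "w = (\<lambda>N. exp (- x * ln (real N)) *
    ((ln (real N) + euler_mascheroni) ^ 2 / x + 2 * (ln (real N) + euler_mascheroni) / x ^ 2 + 2 / x ^ 3))"
  have "w \<longlonglongrightarrow> 0"
    unfolding w_def using assms by real_asymp
  hence "(\<lambda>N. principal_part (of_real x) - of_real (w N)) \<longlonglongrightarrow> principal_part (of_real x) - of_real 0"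
    by (intro tendsto_intros)
  also have "(\<lambda>N. principal_part (of_real x) - of_real (w N)) = (\<lambda>N. exp_antideriv (of_real x) (ln (real N)))"
    using assms by (simp add: exp_antideriv_def w_def fun_eq_iff exp_of_real [symmetric])
  finally show ?thesis by simp
qed

text \<open>Adding \<open>exp_antideriv\<close> back turns \<open>regular_part\<close> into the
  partial sums of the Dirichlet series, so the limit \<open>g\<close> yields both its convergence
  and its value.\<close>

lemma regular_part_limit_eq_dirichlet:
  assumes x: "x > 0" and lim: "(\<lambda>N. regular_part N (of_real x)) \<longlonglongrightarrow> g"
  shows "harm_sq_dirichlet (1 + of_real x) = principal_part (of_real x) + g"
proof -
  have "(\<lambda>N. regular_part N (of_real x) + exp_antideriv (of_real x) (ln (real N)))
      \<longlonglongrightarrow> g + principal_part (of_real x)"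
    by (intro tendsto_add lim exp_antideriv_tendsto_principal_part x)
  also have "(\<lambda>N. regular_part N (of_real x) + exp_antideriv (of_real x) (ln (real N))) =
      (\<lambda>N. \<Sum>k<N. (harm (Suc k))\<^sup>2 * of_nat (Suc k) powr (- (1 + of_real x)))"
  proof
    fix N
    have "of_real ((harm (Suc k))\<^sup>2 / real (Suc k)) * exp (- of_real x * of_real (ln (real (Suc k)))) =
      (harm (Suc k))\<^sup>2 * of_nat (Suc k) powr (- (1 + complex_of_real x))" for k
    proof -
      have "of_nat (Suc k) powr (- (1 + complex_of_real x)) =
        exp (- of_real (ln (real (Suc k))) - of_real x * of_real (ln (real (Suc k))))"
        by (simp add: powr_def algebra_simps del: of_nat_Suc)
      also have "\<dots> = exp (- of_real x * of_real (ln (real (Suc k)))) / of_nat (Suc k)"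
        by (simp add: exp_diff exp_minus exp_of_real field_simps del: of_nat_Suc)
      finally show ?thesis by (simp add: of_real_harm del: of_nat_Suc)
    qed
    thus "regular_part N (of_real x) + exp_antideriv (of_real x) (ln (real N)) =
       (\<Sum>k<N. (harm (Suc k))\<^sup>2 * of_nat (Suc k) powr (- (1 + complex_of_real x)))"
      unfolding regular_part_def by (simp add: sum.atLeast1_atMost_eq)
  qed
  finally have "(\<lambda>k. (harm (Suc k))\<^sup>2 * of_nat (Suc k) powr (- (1 + complex_of_real x))) sums
      (g + principal_part (of_real x))"
    by (simp add: sums_def)
  thus ?thesis
    by (simp add: harm_sq_dirichlet_def sums_iff add.commute)
qed

section \<open>Uniqueness of the coefficients and passage to the continuation\<close>

text \<open>The hypotheses say nothing at u = 0. There the difference series has the value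
  \<open>d 0\<close>, while it vanishes at nearby u \<noteq> 0; continuity of a power series forces
  \<open>d 0 = 0\<close>, and then the usual uniqueness applies.\<close>

lemma eventually_power_series_unique:
  fixes a b :: "nat \<Rightarrow> complex"
  assumes "\<forall>\<^sub>F u in at 0. (\<lambda>n. a n * u ^ n) sums f u"
    and "\<forall>\<^sub>F u in at 0. (\<lambda>n. b n * u ^ n) sums f u"
  shows "a = b"
proof -
  define d where "d = (\<lambda>n. a n - b n)"
  define z where "z = (\<lambda>u::complex. if u = 0 then d 0 else 0)"
  have "\<forall>\<^sub>F u in at 0. (\<lambda>n. d n * u ^ n) sums z u"
    using assms eventually_neq_at_within[of 0]
  proof eventually_elim
    case (elim u)
    from sums_diff[OF elim(1,2)] elim(3) show ?case
      by (simp add: d_def z_def algebra_simps)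
  qed
  moreover have "(\<lambda>n. d n * 0 ^ n) sums z 0"
    using powser_sums_zero[of d] by (simp add: z_def)
  ultimately have exp: "z has_fps_expansion Abs_fps d"
    by (intro has_fps_expansionI) (simp add: eventually_nhds_conv_at)
  have "z \<midarrow>0\<rightarrow> z 0"
    using has_fps_expansion_imp_continuous[OF exp, of UNIV] by (simp add: continuous_at)
  moreover have "z \<midarrow>0\<rightarrow> 0"
    by (rule tendsto_eventually) (auto simp: z_def eventually_at_filter)
  ultimately have "d 0 = 0"
    using tendsto_unique[of "at (0::complex)" z] by (force simp: z_def)
  hence "z = (\<lambda>_. 0)" by (auto simp: z_def)
  with exp have "Abs_fps d = 0"
    using fps_expansion_unique_complex[of "\<lambda>_. 0"] by auto
  thus ?thesis
    by (auto simp: fps_eq_iff d_def fun_eq_iff)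
qed

theorem theorem2:
  fixes F :: "complex \<Rightarrow> complex"
  assumes "harm_sq_continuation F"
  shows "(\<exists>!c. harm_sq_laurent_coeffs F c) \<and>
    (\<forall>c. harm_sq_laurent_coeffs F c \<longrightarrow>
      (\<forall>n::nat.
        (\<lambda>N::nat. complex_of_real
           ((\<Sum>k=1..N. (harm k)\<^sup>2 / real k * ln (real k) ^ n)
             - ln (real N) ^ (n + 3) / real (n + 3)
             - 2 * euler_mascheroni * (ln (real N) ^ (n + 2) / real (n + 2))
             - euler_mascheroni ^ 2 * (ln (real N) ^ (n + 1) / real (n + 1))))
        \<longlonglongrightarrow> c n))"
proof -
  obtain G where G: "uniform_limit (ball 0 (1 / 4)) regular_part G sequentially"
    by (rule regular_part_uniform_limit)
  have holo: "G holomorphic_on ball 0 (1 / 4)"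
  proof (rule holomorphic_uniform_sequence [OF open_ball regular_part_holomorphic])
    fix x :: complex assume "x \<in> ball 0 (1 / 4)"
    then obtain d where "d > 0" "cball x d \<subseteq> ball 0 (1 / 4)"
      using open_ball open_contains_cball by blast
    thus "\<exists>d>0. cball x d \<subseteq> ball 0 (1 / 4) \<and> uniform_limit (cball x d) regular_part G sequentially"
      using uniform_limit_on_subset[OF G] by blast
  qed
  \<comment> \<open>The sign cancels the \<open>(-1) ^ n\<close> built into the Laurent
    coefficients.\<close>
  define c0 where "c0 = (\<lambda>n. (-1) ^ n * (deriv ^^ n) G 0)"
  have bracket: "(\<lambda>N. complex_of_real (laurent_bracket n N)) \<longlonglongrightarrow> c0 n" for n
  proof -
    \<comment> \<open>Uniform convergence of holomorphic functions carries over to all derivatives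
      at 0.\<close>
    have "(\<lambda>N. (deriv ^^ n) (regular_part N) 0) \<longlonglongrightarrow> (deriv ^^ n) G 0"
      using regular_part_holomorphic
      by (intro higher_deriv_complex_uniform_limit [OF G]) auto
    hence "(\<lambda>N. (-1) ^ n * (deriv ^^ n) (regular_part N) 0) \<longlonglongrightarrow> c0 n"
      unfolding c0_def by (rule tendsto_mult_left)
    thus ?thesis
      by (simp add: regular_part_higher_deriv mult.assoc [symmetric] power_mult_distrib [symmetric])
  qed
  \<comment> \<open>\<open>K\<close> is the discrepancy between the continuation and the expected
    expansion; it has to vanish near 1, apart possibly from 1 itself.\<close>
  define K where "K = (\<lambda>s. F s - principal_part (s - 1) - G (s - 1))"
  have mero: "K meromorphic_on {1}"
  proof -
    have "F meromorphic_on {1}"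
      using assms by (auto simp: harm_sq_continuation_def intro: meromorphic_on_subset)
    moreover have "(\<lambda>s. G (s - 1)) holomorphic_on ball 1 (1 / 4)"
      by (rule holomorphic_on_compose_gen [OF _ holo, unfolded o_def])
         (auto intro!: holomorphic_intros simp: dist_norm norm_minus_commute)
    hence "(\<lambda>s. G (s - 1)) analytic_on {1}"
      by (auto simp: analytic_at intro!: exI [of _ "ball 1 (1 / 4)"])
    hence "(\<lambda>s. G (s - 1)) meromorphic_on {1}"
      by (rule analytic_on_imp_meromorphic_on)
    ultimately show ?thesis
      unfolding K_def principal_part_def by (intro meromorphic_intros) auto
  qed
  have zero: "K (1 + of_real x) = 0" if "x > 0" "x < 1 / 4" for x
  proof -
    have "(\<lambda>N. regular_part N (of_real x)) \<longlonglongrightarrow> G (of_real x)"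
      using that by (intro tendsto_uniform_limitI [OF G]) auto
    from regular_part_limit_eq_dirichlet[OF that(1) this] show ?thesis
      using assms that by (simp add: K_def harm_sq_continuation_def)
  qed
  have "\<exists>\<^sub>F s in at 1. K s = 0"
  proof -
    \<comment> \<open>The offset 5 keeps every point within distance 1/4 of 1, where
      \<open>zero\<close> applies.\<close>
    have "filterlim (\<lambda>n. 1 + complex_of_real (1 / real (n + 5))) (at 1) sequentially"
    proof -
      have "(\<lambda>n. 1 / real (n + 5)) \<longlonglongrightarrow> 0" by real_asymp
      hence "(\<lambda>n. 1 + complex_of_real (1 / real (n + 5))) \<longlonglongrightarrow> 1 + of_real 0"
        by (intro tendsto_intros)
      moreover have "1 + complex_of_real (1 / real (n + 5)) \<noteq> 1" for n
        by (simp del: of_nat_add)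
      ultimately show ?thesis by (simp add: filterlim_at)
    qed
    moreover have "K (1 + complex_of_real (1 / real (n + 5))) = 0" for n
      by (rule zero) (auto simp: field_simps)
    ultimately show ?thesis
      unfolding frequently_def using eventually_compose_filterlim by fastforce
  qed
  \<comment> \<open>Identity theorem at a possible pole: a meromorphic function has no essential
    singularity, so zeros accumulating at 1 make it vanish on a punctured neighbourhood.\<close>
  hence "\<forall>\<^sub>F s in at 1. K s = 0"
    using mero by (intro not_essential_frequently_0_imp_eventually_0)
       (auto simp: meromorphic_on_isolated_singularity meromorphic_on_not_essential)
  hence F_eq: "\<forall>\<^sub>F s in at 1. F s - principal_part (s - 1) = G (s - 1)"
    by eventually_elim (simp add: K_def)
  \<comment> \<open>The Laurent condition on \<open>F\<close> becomes a Taylor condition on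
    \<open>G\<close>, to which both existence and uniqueness reduce.\<close>
  have coeffs_iff: "harm_sq_laurent_coeffs F c \<longleftrightarrow>
      (\<forall>\<^sub>F u in at 0. (\<lambda>n. (-1) ^ n / fact n * c n * u ^ n) sums G u)" for c
  proof -
    have "harm_sq_laurent_coeffs F c \<longleftrightarrow>
      (\<forall>\<^sub>F s in at 1. (\<lambda>n. (-1) ^ n / fact n * c n * (s - 1) ^ n) sums G (s - 1))"
      unfolding harm_sq_laurent_coeffs_def
      by (rule eventually_cong [OF F_eq]) (simp add: principal_part_def)
    thus ?thesis
      by (subst (asm) at_to_0) (simp add: eventually_filtermap)
  qed
  have c0: "harm_sq_laurent_coeffs F c0"
  proof -
    have "\<forall>\<^sub>F u in at 0. u \<in> ball (0 :: complex) (1 / 4)"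
      by (intro eventually_at_in_open') auto
    thus ?thesis
      unfolding coeffs_iff
    proof eventually_elim
      case (elim u)
      from holomorphic_power_series[OF holo this] show ?case
        by (simp add: c0_def power_mult_distrib [symmetric] mult.assoc [symmetric])
    qed
  qed
  have unique: "c = c0" if "harm_sq_laurent_coeffs F c" for c
  proof -
    have "(\<lambda>n. (-1) ^ n / fact n * c n) = (\<lambda>n. (-1) ^ n / fact n * c0 n)"
      using that c0 unfolding coeffs_iff by (rule eventually_power_series_unique)
    thus ?thesis by (simp add: fun_eq_iff)
  qed
  have "(\<lambda>N::nat. complex_of_real
           ((\<Sum>k=1..N. (harm k)\<^sup>2 / real k * ln (real k) ^ n)
             - ln (real N) ^ (n + 3) / real (n + 3)
             - 2 * euler_mascheroni * (ln (real N) ^ (n + 2) / real (n + 2))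
             - euler_mascheroni ^ 2 * (ln (real N) ^ (n + 1) / real (n + 1))))
        \<longlonglongrightarrow> c0 n" for n
    using bracket[of n] by (simp add: laurent_bracket_def log_antideriv_def diff_diff_eq add_ac)
  with c0 unique show ?thesis by blast
qed

end
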